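(* Let $n\ge 1$ and let $f,g\in\mathcal{A}_n=\mathbb{R}[t_1,\dots,t_n]/(t_1^2,\dots,t_n^2)$ satisfy $f_\varnothing=g_\varnothing=1$. Then $$\log(f\boxplus g)=\log f+\log g .$$ Equivalently, $\kappa_S(f\boxplus g)=\kappa_S(f)+\kappa_S(g)$ for every nonempty $S\subseteq[n]$.
   Context: $[n]=\{1,\dots,n\}$. The squarefree algebra $\mathcal{A}_n:=\mathbb{R}[t_1,\dots,t_n]/(t_1^2,\dots,t_n^2)$ has basis $\{t^S: S\subseteq[n]\}$ with $t^S:=\prod_{i\in S}t_i$, $t^\varnothing=1$. An element is written $f=\sum_{S\subseteq[n]}f_S t^S$ with $f_S\in\mathbb{R}$. Additive convolution: $f\boxplus g\in\mathcal{A}_n$ has coefficients $(f\boxplus g)_S:=\sum_{A\subseteq S}f_A\,g_{S\setminus A}$ for all $S\subseteq[n]$. For $f\in\mathcal{A}_n$ with $f_\varnothing=1$, the element $f-1$ is nilpotent with $(f-1)^{n+1}=0$, and one defines $$\log f:=\sum_{k=1}^n\frac{(-1)^{k+1}}{k}(f-1)^k=\sum_{\varnothing\ne S\subseteq[n]}\kappa_S(f)\,t^S.$$ The coefficients $\kappa_S(f)$ are called the squarefree cumulants of $f$. *)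

theory Defs
  imports Complex_Main "HOL-Library.Poly_Mapping" "HOL-Library.Cardinality"
begin

text \<open>
  The polynomial ring in the variables indexed by a finite type \<open>'n\<close> is
  \<open>('n \<Rightarrow>\<^sub>0 nat) \<Rightarrow>\<^sub>0 real\<close>: exponent vectors are finitely supported maps
  \<open>'n \<Rightarrow>\<^sub>0 nat\<close>. The index set $[n]$ is the universe of \<open>'n\<close>, so \<open>n = CARD('n)\<close>.
\<close>

type_synonym 'n real_mpoly = "('n \<Rightarrow>\<^sub>0 nat) \<Rightarrow>\<^sub>0 real"

definition pvar :: "'n \<Rightarrow> 'n real_mpoly"
  where "pvar i = Poly_Mapping.single (Poly_Mapping.single i 1) 1"

definition pconst :: "real \<Rightarrow> 'n real_mpoly"
  where "pconst c = Poly_Mapping.single 0 c"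

definition square_ideal :: "('n::finite) real_mpoly set"
  where "square_ideal = {\<Sum>i\<in>UNIV. q i * pvar i ^ 2 | q. True}"

definition square_cong :: "('n::finite) real_mpoly \<Rightarrow> 'n real_mpoly \<Rightarrow> bool"
  where "square_cong p q \<longleftrightarrow> p - q \<in> square_ideal"

text \<open>Exponent vector of the squarefree monomial with support \<open>S\<close>.\<close>

definition sqfree_exp :: "('n::finite) set \<Rightarrow> ('n \<Rightarrow>\<^sub>0 nat)"
  where "sqfree_exp S = (\<Sum>i\<in>S. Poly_Mapping.single i 1)"

lemma square_ideal_zero: "0 \<in> square_ideal"
  unfolding square_ideal_def by (auto intro!: exI[of _ "\<lambda>_. 0"])

lemma square_ideal_add: "p \<in> square_ideal \<Longrightarrow> q \<in> square_ideal \<Longrightarrow> p + q \<in> square_ideal"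
proof -
  assume "p \<in> square_ideal" "q \<in> square_ideal"
  then obtain a b where "p = (\<Sum>i\<in>UNIV. a i * pvar i ^ 2)" "q = (\<Sum>i\<in>UNIV. b i * pvar i ^ 2)"
    unfolding square_ideal_def by auto
  then have "p + q = (\<Sum>i\<in>UNIV. (a i + b i) * pvar i ^ 2)"
    by (simp add: sum.distrib distrib_right)
  then show ?thesis unfolding square_ideal_def by (auto intro!: exI[of _ "\<lambda>i. a i + b i"])
qed

lemma square_ideal_mult: "p \<in> square_ideal \<Longrightarrow> r * p \<in> square_ideal"
proof -
  assume "p \<in> square_ideal"
  then obtain a where "p = (\<Sum>i\<in>UNIV. a i * pvar i ^ 2)"
    unfolding square_ideal_def by auto
  then have "r * p = (\<Sum>i\<in>UNIV. (r * a i) * pvar i ^ 2)"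
    by (simp add: sum_distrib_left mult.assoc)
  then show ?thesis unfolding square_ideal_def by (auto intro!: exI[of _ "\<lambda>i. r * a i"])
qed

lemma square_ideal_uminus: "p \<in> square_ideal \<Longrightarrow> - p \<in> square_ideal"
  using square_ideal_mult[of p "-1"] by simp

lemma square_ideal_sum: "(\<And>x. x \<in> X \<Longrightarrow> h x \<in> square_ideal) \<Longrightarrow> sum h X \<in> square_ideal"
  by (induction X rule: infinite_finite_induct) (auto intro: square_ideal_zero square_ideal_add)

lemma square_ideal_gen: "q * pvar i ^ 2 \<in> square_ideal"
proof -
  have "q * pvar i ^ 2 = (\<Sum>j\<in>UNIV. (if j = i then q else 0) * pvar j ^ 2)"
    by (simp add: if_distrib[of "\<lambda>x. x * _"] sum.delta cong: if_cong)
  then show ?thesis unfolding square_ideal_def by (auto intro!: exI[of _ "\<lambda>j. if j = i then q else 0"])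
qed

lemma pvar_power2: "pvar i ^ 2 = Poly_Mapping.single (Poly_Mapping.single i 2) 1"
  by (simp add: pvar_def power2_eq_square mult_single flip: single_add numeral_2_eq_2)

lemma lookup_sqfree_exp: "Poly_Mapping.lookup (sqfree_exp S) i = (if i \<in> S then 1 else 0)"
  by (simp add: sqfree_exp_def lookup_sum lookup_single when_def sum.delta)

lemma sqfree_exp_empty [simp]: "sqfree_exp {} = 0"
  by (simp add: sqfree_exp_def)

lemma sqfree_exp_inject: "sqfree_exp S = sqfree_exp T \<longleftrightarrow> S = T"
proof
  assume "sqfree_exp S = sqfree_exp T"
  then have "i \<in> S \<longleftrightarrow> i \<in> T" for i
    by (metis lookup_sqfree_exp zero_neq_one)
  then show "S = T" by blast
qed simp

lemma lookup_square_ideal: "p \<in> square_ideal \<Longrightarrow> Poly_Mapping.lookup p (sqfree_exp S) = 0"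
proof -
  have "Poly_Mapping.lookup (q * pvar i ^ 2) (sqfree_exp S) = 0" for q and i :: 'a
  proof (rule ccontr)
    assume "Poly_Mapping.lookup (q * pvar i ^ 2) (sqfree_exp S) \<noteq> 0"
    then have "sqfree_exp S \<in> Poly_Mapping.keys (q * pvar i ^ 2)"
      by (simp add: in_keys_iff)
    then obtain a where "sqfree_exp S = a + Poly_Mapping.single i 2"
      using keys_mult[of q "pvar i ^ 2"] by (auto simp: pvar_power2)
    then have "Poly_Mapping.lookup (sqfree_exp S) i \<ge> 2"
      by (simp add: lookup_add)
    then show False by (simp add: lookup_sqfree_exp split: if_splits)
  qed
  then show "p \<in> square_ideal \<Longrightarrow> Poly_Mapping.lookup p (sqfree_exp S) = 0"
    by (auto simp: square_ideal_def lookup_sum)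
qed

lemma square_cong_equivp: "equivp square_cong"
proof (rule equivpI)
  show "reflp square_cong"
    by (auto simp: reflp_def square_cong_def square_ideal_zero)
  show "symp square_cong"
    using square_ideal_uminus by (fastforce simp: symp_def square_cong_def)
  show "transp square_cong"
    using square_ideal_add by (fastforce simp: transp_def square_cong_def)
qed

text \<open>The squarefree algebra: polynomials modulo the ideal generated by all squares of variables.\<close>

quotient_type 'n sqfree_alg = "(('n::finite) \<Rightarrow>\<^sub>0 nat) \<Rightarrow>\<^sub>0 real" / square_cong
  by (rule square_cong_equivp)

instantiation sqfree_alg :: (finite) comm_ring_1
begin

lift_definition zero_sqfree_alg :: "'a sqfree_alg" is 0 .

lift_definition one_sqfree_alg :: "'a sqfree_alg" is 1 .

lift_definition plus_sqfree_alg :: "'a sqfree_alg \<Rightarrow> 'a sqfree_alg \<Rightarrow> 'a sqfree_alg" is "(+)"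
  unfolding square_cong_def by (metis add_diff_add square_ideal_add)

lift_definition uminus_sqfree_alg :: "'a sqfree_alg \<Rightarrow> 'a sqfree_alg" is uminus
  unfolding square_cong_def by (metis minus_diff_minus square_ideal_uminus)

lift_definition minus_sqfree_alg :: "'a sqfree_alg \<Rightarrow> 'a sqfree_alg \<Rightarrow> 'a sqfree_alg" is "(-)"
proof -
  fix a b c d :: "'a real_mpoly"
  assume "square_cong a b" "square_cong c d"
  then have "(a - b) + - (c - d) \<in> square_ideal"
    unfolding square_cong_def by (intro square_ideal_add square_ideal_uminus)
  then show "square_cong (a - c) (b - d)"
    by (simp add: square_cong_def algebra_simps)
qed

lift_definition times_sqfree_alg :: "'a sqfree_alg \<Rightarrow> 'a sqfree_alg \<Rightarrow> 'a sqfree_alg" is "(*)"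
proof -
  fix a b c d :: "'a real_mpoly"
  assume "square_cong a b" "square_cong c d"
  then have "c * (a - b) + b * (c - d) \<in> square_ideal"
    unfolding square_cong_def by (intro square_ideal_add square_ideal_mult)
  then show "square_cong (a * c) (b * d)"
    by (simp add: square_cong_def algebra_simps)
qed

instance
proof
  show "(0 :: 'a sqfree_alg) \<noteq> 1"
  proof transfer
    show "\<not> square_cong (0 :: 'a real_mpoly) 1"
      using lookup_square_ideal[of "-1 :: 'a real_mpoly" "{}"] by (auto simp: square_cong_def)
  qed
qed (transfer; simp add: square_cong_def algebra_simps square_ideal_zero)+

end

lemma pconst_add: "pconst (a + b) = pconst a + pconst b"
  by (simp add: pconst_def single_add)

lemma pconst_mult: "pconst (a * b) = pconst a * pconst b"
  by (simp add: pconst_def mult_single)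

lemma pconst_1: "pconst 1 = 1"
  by (simp add: pconst_def)

instantiation sqfree_alg :: (finite) real_algebra_1
begin

lift_definition scaleR_sqfree_alg :: "real \<Rightarrow> 'a sqfree_alg \<Rightarrow> 'a sqfree_alg"
  is "\<lambda>c p. pconst c * p"
  unfolding square_cong_def by (metis right_diff_distrib square_ideal_mult)

instance
  by standard (transfer; simp add: square_cong_def pconst_add pconst_mult pconst_1
      algebra_simps square_ideal_zero)+

end

lift_definition tvar :: "'n::finite \<Rightarrow> 'n sqfree_alg" is pvar .

definition tmon :: "('n::finite) set \<Rightarrow> 'n sqfree_alg"
  where "tmon S = (\<Prod>i\<in>S. tvar i)"

text \<open>The coordinate $f_S$; \<open>sqfree_expansion\<close> and \<open>sqfree_coeff_sum_tmon\<close> below say that these are the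
  coordinates with respect to the basis $(t^S)_S$.\<close>

lift_definition sqfree_coeff :: "('n::finite) sqfree_alg \<Rightarrow> 'n set \<Rightarrow> real"
  is "\<lambda>p S. Poly_Mapping.lookup p (sqfree_exp S)"
  using lookup_square_ideal by (fastforce simp: square_cong_def lookup_minus fun_eq_iff)

definition boxplus :: "('n::finite) sqfree_alg \<Rightarrow> 'n sqfree_alg \<Rightarrow> 'n sqfree_alg"
    (infixl \<open>\<boxplus>\<close> 65)
  where "f \<boxplus> g = (\<Sum>S\<in>UNIV. (\<Sum>A\<in>Pow S. sqfree_coeff f A * sqfree_coeff g (S - A)) *\<^sub>R tmon S)"

text \<open>Only meaningful when $f_\emptyset = 1$, where \<open>f - 1\<close> is nilpotent and the truncated
  series is the full logarithm series.\<close>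

definition sqfree_log :: "('n::finite) sqfree_alg \<Rightarrow> 'n sqfree_alg"
  where "sqfree_log f = (\<Sum>k = 1..CARD('n). ((-1) ^ (k + 1) / real k) *\<^sub>R (f - 1) ^ k)"

definition cumulant :: "('n::finite) set \<Rightarrow> 'n sqfree_alg \<Rightarrow> real"
  where "cumulant S f = sqfree_coeff (sqfree_log f) S"

lemma abs_sum: "abs_sqfree_alg (\<Sum>x\<in>X. h x) = (\<Sum>x\<in>X. abs_sqfree_alg (h x))"
  by (induction X rule: infinite_finite_induct)
    (auto simp: zero_sqfree_alg.abs_eq plus_sqfree_alg.abs_eq[symmetric])

lemma abs_prod: "abs_sqfree_alg (\<Prod>x\<in>X. h x) = (\<Prod>x\<in>X. abs_sqfree_alg (h x))"
  by (induction X rule: infinite_finite_induct)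
    (auto simp: one_sqfree_alg.abs_eq times_sqfree_alg.abs_eq[symmetric])

lemma prod_pvar: "finite S \<Longrightarrow> (\<Prod>i\<in>S. pvar i) = Poly_Mapping.single (sqfree_exp S) 1"
  by (induction S rule: finite_induct)
    (auto simp: sqfree_exp_def pvar_def mult_single)

lemma tmon_abs: "tmon S = abs_sqfree_alg (Poly_Mapping.single (sqfree_exp S) 1)"
  by (simp add: tmon_def tvar.abs_eq abs_prod flip: prod_pvar)

lemma scaleR_tmon_abs: "c *\<^sub>R tmon S = abs_sqfree_alg (Poly_Mapping.single (sqfree_exp S) c)"
  by (simp add: tmon_abs scaleR_sqfree_alg.abs_eq pconst_def mult_single)

lemma sqfree_coeff_sum_tmon: "sqfree_coeff (\<Sum>S\<in>UNIV. c S *\<^sub>R tmon S) T = c T"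
  by (simp add: scaleR_tmon_abs sqfree_coeff.abs_eq lookup_sum lookup_single when_def
      sqfree_exp_inject sum.delta flip: abs_sum)

lemma square_cong_expand:
  "square_cong p (\<Sum>S\<in>UNIV. Poly_Mapping.single (sqfree_exp S) (Poly_Mapping.lookup p (sqfree_exp S)))"
  for p :: "('n::finite) real_mpoly"
proof (induction p rule: update_induct)
  case const
  then show ?case by (simp add: square_cong_def square_ideal_zero)
next
  case (update p m c)
  let ?e = "\<lambda>p. \<Sum>S\<in>UNIV. Poly_Mapping.single (sqfree_exp S) (Poly_Mapping.lookup p (sqfree_exp S)) :: 'n real_mpoly"
  have upd: "Poly_Mapping.update m c p = p + Poly_Mapping.single m c"
    using update(1) by (intro poly_mapping_eqI)
      (auto simp: lookup_update lookup_add lookup_single when_def in_keys_iff)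
  have e: "?e (Poly_Mapping.update m c p) = ?e p + ?e (Poly_Mapping.single m c)"
    unfolding upd by (simp add: lookup_add single_add sum.distrib)
  have "square_cong (Poly_Mapping.single m c) (?e (Poly_Mapping.single m c))"
  proof (cases "\<exists>S. m = sqfree_exp S")
    case True
    then obtain S where S: "m = sqfree_exp S" by blast
    have "?e (Poly_Mapping.single m c) = (\<Sum>T\<in>UNIV. if T = S then Poly_Mapping.single m c else 0)"
      by (rule sum.cong) (auto simp: S lookup_single sqfree_exp_inject when_def)
    then show ?thesis by (simp add: square_cong_def square_ideal_zero)
  next
    case False
    then have "?e (Poly_Mapping.single m c) = 0"
      by (intro sum.neutral) (auto simp: lookup_single when_def)
    moreover have "\<exists>i. Poly_Mapping.lookup m i \<ge> 2"
    proof (rule ccontr)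
      assume *: "\<not> (\<exists>i. Poly_Mapping.lookup m i \<ge> 2)"
      have "m = sqfree_exp {i. Poly_Mapping.lookup m i \<noteq> 0}"
      proof (rule poly_mapping_eqI)
        fix i
        have "Poly_Mapping.lookup m i < 2" using * by (meson not_le)
        then show "Poly_Mapping.lookup m i = Poly_Mapping.lookup (sqfree_exp {i. Poly_Mapping.lookup m i \<noteq> 0}) i"
          by (auto simp: lookup_sqfree_exp)
      qed
      with False show False by blast
    qed
    then obtain i where i: "Poly_Mapping.lookup m i \<ge> 2" by blast
    have "m = (m - Poly_Mapping.single i 2) + Poly_Mapping.single i 2"
      using i by (intro poly_mapping_eqI) (auto simp: lookup_add lookup_minus lookup_single when_def)
    then have "Poly_Mapping.single m c
        = Poly_Mapping.single (m - Poly_Mapping.single i 2) c * pvar i ^ 2"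
      by (simp add: pvar_power2 mult_single)
    then have "Poly_Mapping.single m c \<in> square_ideal"
      using square_ideal_gen by metis
    ultimately show ?thesis by (simp add: square_cong_def)
  qed
  then have "(p - ?e p) + (Poly_Mapping.single m c - ?e (Poly_Mapping.single m c)) \<in> square_ideal"
    using update(3) unfolding square_cong_def by (rule square_ideal_add[rotated])
  then show ?case
    unfolding square_cong_def e by (simp add: upd algebra_simps)
qed

lemma sqfree_expansion: "f = (\<Sum>S\<in>UNIV. sqfree_coeff f S *\<^sub>R tmon S)"
proof (induction f rule: sqfree_alg.abs_induct)
  case (1 p)
  show ?case
    using square_cong_expand[of p]
    by (simp add: scaleR_tmon_abs sqfree_coeff.abs_eq sqfree_alg.abs_eq_iff flip: abs_sum)
qed

lemma sqfree_coeff_boxplus: "sqfree_coeff (f \<boxplus> g) S = (\<Sum>A\<in>Pow S. sqfree_coeff f A * sqfree_coeff g (S - A))"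
  by (simp add: boxplus_def sqfree_coeff_sum_tmon)

end

theory Submission
  imports Defs
begin

text \<open>
  The convolution \<open>\<boxplus>\<close> is the multiplication of the algebra, so the claim is
  $\log (fg) = \log f + \log g$. The Euler operator $D\,t^S = |S|\,t^S$ is a derivation, and the
  geometric series gives $f \cdot D (\log f) = D f$. Hence $fg$ annihilates
  $D (\log (fg) - \log f - \log g)$; as $fg$ is a unit, that element is zero. The kernel of \<open>D\<close>
  consists of the constants, and every logarithm has constant term zero.
\<close>

lemma sqfree_coeff_zero [simp]: "sqfree_coeff 0 S = 0"
  by transfer simp

lemma sqfree_coeff_one: "sqfree_coeff 1 S = (if S = {} then 1 else 0)"
  by transfer (auto simp: lookup_one when_def sqfree_exp_inject simp flip: sqfree_exp_empty)

lemma sqfree_coeff_add [simp]: "sqfree_coeff (f + g) S = sqfree_coeff f S + sqfree_coeff g S"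
  by transfer (simp add: lookup_add)

lemma sqfree_coeff_diff [simp]: "sqfree_coeff (f - g) S = sqfree_coeff f S - sqfree_coeff g S"
  by transfer (simp add: lookup_minus)

lemma sqfree_coeff_sum: "sqfree_coeff (sum h X) S = (\<Sum>x\<in>X. sqfree_coeff (h x) S)"
  by (induction X rule: infinite_finite_induct) auto

lemma sqfree_alg_eqI:
  assumes "\<And>S. sqfree_coeff f S = sqfree_coeff g S"
  shows "f = g"
  by (subst (1 2) sqfree_expansion) (simp add: assms)

lemma sqfree_coeff_scaleR [simp]: "sqfree_coeff (c *\<^sub>R f) S = c * sqfree_coeff f S"
proof -
  have "c *\<^sub>R f = (\<Sum>T\<in>UNIV. (c * sqfree_coeff f T) *\<^sub>R tmon T)"
    by (subst (1) sqfree_expansion[of f]) (simp add: scaleR_sum_right)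
  then show ?thesis
    by (simp add: sqfree_coeff_sum_tmon)
qed

lemma sqfree_coeff_tmon: "sqfree_coeff (tmon S) T = (if T = S then 1 else 0)"
  by (auto simp: tmon_abs sqfree_coeff.abs_eq lookup_single when_def sqfree_exp_inject)

lemma tvar_mult_self: "tvar i * tvar i = 0"
  by transfer (use square_ideal_gen[of 1] in \<open>simp add: square_cong_def power2_eq_square\<close>)

text \<open>A common index contributes the factor \<open>tvar i * tvar i\<close>, which
  vanishes.\<close>

lemma tmon_mult: "tmon S * tmon T = (if S \<inter> T = {} then tmon (S \<union> T) else 0)"
proof (cases "S \<inter> T = {}")
  case True
  then show ?thesis
    by (simp add: tmon_def prod.union_disjoint)
next
  case False
  then obtain i where "i \<in> S" "i \<in> T"
    by blast
  then have "tmon S * tmon T = (tvar i * tvar i) * (tmon (S - {i}) * tmon (T - {i}))"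
    by (simp add: tmon_def prod.remove[of _ i] ac_simps)
  with False show ?thesis
    by (simp add: tvar_mult_self)
qed

text \<open>Multiplying the two basis expansions, only disjoint pairs with union \<open>U\<close>
  contribute. This is the formula that defines the coefficients of the convolution.\<close>

lemma sqfree_coeff_mult:
  "sqfree_coeff (f * g) U = (\<Sum>A\<in>Pow U. sqfree_coeff f A * sqfree_coeff g (U - A))"
proof -
  have "f * g = (\<Sum>S\<in>UNIV. sqfree_coeff f S *\<^sub>R tmon S) * (\<Sum>T\<in>UNIV. sqfree_coeff g T *\<^sub>R tmon T)"
    by (simp flip: sqfree_expansion)
  also have "\<dots> = (\<Sum>S\<in>UNIV. \<Sum>T\<in>UNIV. (sqfree_coeff f S * sqfree_coeff g T) *\<^sub>R (tmon S * tmon T))"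
    by (simp add: sum_product mult.commute[of "sqfree_coeff g _"])
  finally have "sqfree_coeff (f * g) U = (\<Sum>S\<in>UNIV. \<Sum>T\<in>UNIV.
      sqfree_coeff f S * sqfree_coeff g T * sqfree_coeff (tmon S * tmon T) U)"
    by (simp add: sqfree_coeff_sum)
  \<comment> \<open>\<open>S\<close> and \<open>T\<close> are disjoint with union \<open>U\<close>
    exactly when \<open>S\<close> lies in \<open>U\<close> and \<open>T = U - S\<close>. Testing
    \<open>T\<close> first lets the inner sum collapse to a single term.\<close>
  also have "\<dots> = (\<Sum>S\<in>UNIV. \<Sum>T\<in>UNIV.
      if T = U - S then if S \<in> Pow U then sqfree_coeff f S * sqfree_coeff g T else 0 else 0)"
    by (intro sum.cong refl) (auto simp: tmon_mult sqfree_coeff_tmon)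
  also have "\<dots> = (\<Sum>S\<in>UNIV. if S \<in> Pow U then sqfree_coeff f S * sqfree_coeff g (U - S) else 0)"
    by simp
  also have "\<dots> = (\<Sum>A\<in>Pow U. sqfree_coeff f A * sqfree_coeff g (U - A))"
    by (subst sum.inter_restrict[symmetric]) auto
  finally show ?thesis .
qed

lemma boxplus_eq_mult: "f \<boxplus> g = f * g"
  by (intro sqfree_alg_eqI) (simp add: sqfree_coeff_boxplus sqfree_coeff_mult)

text \<open>Without a constant term, each of the \<open>k\<close> factors must take a nonempty block
  of \<open>S\<close>, and the blocks are disjoint; \<open>S\<close> is too small for that.\<close>

lemma sqfree_coeff_power_eq_0:
  assumes "sqfree_coeff u {} = 0" and "card S < k"
  shows "sqfree_coeff (u ^ k) S = 0"
  using assms(2)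
proof (induction k arbitrary: S)
  case (Suc k)
  have "sqfree_coeff u A * sqfree_coeff (u ^ k) (S - A) = 0" if "A \<subseteq> S" for A
  proof (cases "A = {}")
    case False
    with that have "0 < card A" "card A \<le> card S"
      by (simp_all add: card_gt_0_iff card_mono)
    moreover have "card (S - A) = card S - card A"
      using that by (simp add: card_Diff_subset)
    ultimately have "card (S - A) < k"
      using Suc.prems by simp
    then show ?thesis
      using Suc.IH by simp
  qed (simp add: assms)
  then show ?case
    by (simp add: sqfree_coeff_mult sum.neutral)
qed simp

lemma sqfree_power_eq_0:
  fixes u :: "'n::finite sqfree_alg"
  assumes "sqfree_coeff u {} = 0" and "CARD('n) < k"
  shows "u ^ k = 0"
proof (rule sqfree_alg_eqI)
  fix S :: "'n set"
  have "card S \<le> CARD('n)"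
    by (simp add: card_mono)
  then show "sqfree_coeff (u ^ k) S = sqfree_coeff 0 S"
    using assms by (simp add: sqfree_coeff_power_eq_0)
qed

text \<open>Iterating \<open>x = (1 - f) * x\<close> until the nilpotent factor vanishes avoids
  constructing an inverse of \<open>f\<close>.\<close>

lemma sqfree_mult_eq_0D:
  fixes f x :: "'n::finite sqfree_alg"
  assumes "sqfree_coeff f {} = 1" and "f * x = 0"
  shows "x = 0"
proof -
  have x: "x = (1 - f) * x"
    using assms(2) by (simp add: algebra_simps)
  have "x = (1 - f) ^ k * x" for k
  proof (induction k)
    case (Suc k)
    then show ?case
      using x by (metis mult.assoc power_Suc2)
  qed simp
  moreover have "(1 - f) ^ Suc CARD('n) = 0"
    using assms(1) by (intro sqfree_power_eq_0) (auto simp: sqfree_coeff_one)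
  ultimately show ?thesis
    by (metis mult_zero_left)
qed

text \<open>This is the sum of t_i d/dt_i. A single d/dt_i does not descend to the quotient, since
  it sends t_i^2 to 2 t_i, whereas t_i d/dt_i preserves the ideal of squares.\<close>

definition sqfree_euler :: "'n::finite sqfree_alg \<Rightarrow> 'n sqfree_alg"
  where "sqfree_euler f = (\<Sum>S\<in>UNIV. (real (card S) * sqfree_coeff f S) *\<^sub>R tmon S)"

lemma sqfree_coeff_euler: "sqfree_coeff (sqfree_euler f) S = real (card S) * sqfree_coeff f S"
  by (simp add: sqfree_euler_def sqfree_coeff_sum_tmon)

lemma sqfree_euler_0 [simp]: "sqfree_euler 0 = 0"
  by (intro sqfree_alg_eqI) (simp add: sqfree_coeff_euler)

lemma sqfree_euler_1 [simp]: "sqfree_euler 1 = 0"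
  by (intro sqfree_alg_eqI) (simp add: sqfree_coeff_euler sqfree_coeff_one)

lemma sqfree_euler_add: "sqfree_euler (f + g) = sqfree_euler f + sqfree_euler g"
  by (intro sqfree_alg_eqI) (simp add: sqfree_coeff_euler algebra_simps)

lemma sqfree_euler_diff: "sqfree_euler (f - g) = sqfree_euler f - sqfree_euler g"
  by (intro sqfree_alg_eqI) (simp add: sqfree_coeff_euler algebra_simps)

lemma sqfree_euler_scaleR: "sqfree_euler (c *\<^sub>R f) = c *\<^sub>R sqfree_euler f"
  by (intro sqfree_alg_eqI) (simp add: sqfree_coeff_euler)

lemma sqfree_euler_sum: "sqfree_euler (sum h X) = (\<Sum>x\<in>X. sqfree_euler (h x))"
  by (induction X rule: infinite_finite_induct) (auto simp: sqfree_euler_add)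

text \<open>The Leibniz rule comes from splitting the weight of \<open>S\<close> as the weight of
  \<open>A\<close> plus the weight of \<open>S - A\<close> in each term of the product
  formula.\<close>

lemma sqfree_euler_mult: "sqfree_euler (f * g) = sqfree_euler f * g + f * sqfree_euler g"
proof (rule sqfree_alg_eqI)
  fix S :: "'a set"
  have "sqfree_coeff (sqfree_euler (f * g)) S
      = (\<Sum>A\<in>Pow S. real (card S) * (sqfree_coeff f A * sqfree_coeff g (S - A)))"
    by (simp only: sqfree_coeff_euler sqfree_coeff_mult sum_distrib_left)
  also have "\<dots> = (\<Sum>A\<in>Pow S. real (card A) * sqfree_coeff f A * sqfree_coeff g (S - A)
      + sqfree_coeff f A * (real (card (S - A)) * sqfree_coeff g (S - A)))"
  proof (rule sum.cong)
    fix A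
    assume "A \<in> Pow S"
    then have "real (card S) = real (card A) + real (card (S - A))"
      by (simp add: card_Diff_subset card_mono of_nat_diff)
    then show "real (card S) * (sqfree_coeff f A * sqfree_coeff g (S - A))
        = real (card A) * sqfree_coeff f A * sqfree_coeff g (S - A)
        + sqfree_coeff f A * (real (card (S - A)) * sqfree_coeff g (S - A))"
      by (simp only: distrib_left distrib_right mult_ac)
  qed simp
  also have "\<dots> = sqfree_coeff (sqfree_euler f * g + f * sqfree_euler g) S"
    by (simp only: sqfree_coeff_add sqfree_coeff_mult sqfree_coeff_euler sum.distrib)
  finally show "sqfree_coeff (sqfree_euler (f * g)) S
      = sqfree_coeff (sqfree_euler f * g + f * sqfree_euler g) S" .
qed

lemma sqfree_euler_power_Suc: "sqfree_euler (f ^ Suc k) = real (Suc k) *\<^sub>R (f ^ k * sqfree_euler f)"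
proof (induction k)
  case (Suc k)
  have "sqfree_euler (f ^ Suc (Suc k)) = sqfree_euler f * f ^ Suc k + f * sqfree_euler (f ^ Suc k)"
    by (simp only: power_Suc[of f "Suc k"] sqfree_euler_mult)
  also have "\<dots> = real (Suc (Suc k)) *\<^sub>R (f ^ Suc k * sqfree_euler f)"
    by (simp only: Suc.IH of_nat_Suc[of "Suc k"] scaleR_left_distrib)
      (simp add: mult_ac del: of_nat_Suc)
  finally show ?case .
qed simp

lemma sqfree_euler_log:
  fixes f :: "'n::finite sqfree_alg"
  assumes "sqfree_coeff f {} = 1"
  shows "f * sqfree_euler (sqfree_log f) = sqfree_euler f"
proof -
  let ?u = "f - 1" and ?n = "CARD('n)"
  \<comment> \<open>The index is shifted down by one so that the denominator
    \<open>real (Suc k)\<close> cancels against the factor from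
    \<open>sqfree_euler_power_Suc\<close>.\<close>
  have "sqfree_log f = (\<Sum>k<?n. ((-1) ^ k / real (Suc k)) *\<^sub>R ?u ^ Suc k)"
    by (simp add: sqfree_log_def sum.atLeast1_atMost_eq)
  then have "sqfree_euler (sqfree_log f) = (\<Sum>k<?n. (-1) ^ k *\<^sub>R (?u ^ k * sqfree_euler ?u))"
    by (simp add: sqfree_euler_sum sqfree_euler_scaleR sqfree_euler_power_Suc del: power_Suc of_nat_Suc)
  also have "\<dots> = (\<Sum>k<?n. (1 - f) ^ k) * sqfree_euler f"
  proof -
    have "(- u) ^ k = (-1) ^ k *\<^sub>R u ^ k" for k and u :: "'n sqfree_alg"
      by (induction k) auto
    from this[of ?u] have "(1 - f) ^ k = (-1) ^ k *\<^sub>R ?u ^ k" for k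
      by simp
    then show ?thesis
      by (simp add: sum_distrib_right sqfree_euler_diff)
  qed
  finally have "f * sqfree_euler (sqfree_log f) = (f * (\<Sum>k<?n. (1 - f) ^ k)) * sqfree_euler f"
    by (simp add: mult.assoc)
  also have "f * (\<Sum>k<?n. (1 - f) ^ k) = 1 - (1 - f) ^ ?n"
    using one_diff_power_eq[of "1 - f" ?n] by simp
  \<comment> \<open>The remainder \<open>(1 - f) ^ ?n\<close> of the geometric sum need not be zero;
    only the next power is sure to vanish. Applying the Euler operator to that vanishing power shows
    that the remainder annihilates \<open>sqfree_euler f\<close>.\<close>
  also have "(1 - (1 - f) ^ ?n) * sqfree_euler f = sqfree_euler f"
  proof -
    have "(1 - f) ^ Suc ?n = 0"
      using assms by (intro sqfree_power_eq_0) (auto simp: sqfree_coeff_one)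
    then have "real (Suc ?n) *\<^sub>R ((1 - f) ^ ?n * sqfree_euler (1 - f)) = 0"
      by (simp only: sqfree_euler_0 flip: sqfree_euler_power_Suc)
    then have "(1 - f) ^ ?n * sqfree_euler f = 0"
      by (simp add: sqfree_euler_diff del: of_nat_Suc)
    then show ?thesis
      by (simp add: left_diff_distrib)
  qed
  finally show ?thesis .
qed

text \<open>The series starts at \<open>k = 1\<close>, so every power in it has zero constant
  term.\<close>

lemma sqfree_coeff_log_empty:
  assumes "sqfree_coeff f {} = 1"
  shows "sqfree_coeff (sqfree_log f) {} = 0"
  using assms unfolding sqfree_log_def sqfree_coeff_sum sqfree_coeff_scaleR
  by (intro sum.neutral) (simp add: sqfree_coeff_power_eq_0 sqfree_coeff_one)

text \<open>The weight \<open>card S\<close> is zero only for the empty set, so the constant term is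
  the one coordinate that the Euler operator forgets.\<close>

lemma sqfree_euler_eq_0D:
  assumes "sqfree_euler f = 0" and "sqfree_coeff f {} = 0"
  shows "f = 0"
proof (rule sqfree_alg_eqI)
  fix S
  have "real (card S) * sqfree_coeff f S = 0"
    using assms(1) by (simp flip: sqfree_coeff_euler)
  with assms(2) show "sqfree_coeff f S = sqfree_coeff 0 S"
    by (cases "S = {}") auto
qed

lemma sqfree_log_mult:
  assumes f: "sqfree_coeff f {} = 1" and g: "sqfree_coeff g {} = 1"
  shows "sqfree_log (f * g) = sqfree_log f + sqfree_log g"
proof -
  let ?d = "sqfree_log (f * g) - sqfree_log f - sqfree_log g"
  have fg: "sqfree_coeff (f * g) {} = 1"
    using f g by (simp add: sqfree_coeff_mult)
  \<comment> \<open>The factor \<open>f * g\<close> is regrouped so that each logarithm meets its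
    own argument; the three terms then cancel by the Leibniz rule.\<close>
  have "f * g * sqfree_euler ?d = f * g * sqfree_euler (sqfree_log (f * g))
      - g * (f * sqfree_euler (sqfree_log f)) - f * (g * sqfree_euler (sqfree_log g))"
    by (simp only: sqfree_euler_diff right_diff_distrib mult_ac)
  also have "\<dots> = 0"
    unfolding sqfree_euler_log[OF fg] sqfree_euler_log[OF f] sqfree_euler_log[OF g] sqfree_euler_mult
    by (simp add: algebra_simps)
  finally have "sqfree_euler ?d = 0"
    by (rule sqfree_mult_eq_0D[OF fg])
  then have "?d = 0"
    by (rule sqfree_euler_eq_0D) (simp add: sqfree_coeff_log_empty f g fg)
  then show ?thesis
    by (simp add: algebra_simps)
qed

theorem mainTheorem1:
  fixes f g :: "('n::finite) sqfree_alg"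
  assumes "sqfree_coeff f {} = 1" and "sqfree_coeff g {} = 1"
  shows "sqfree_log (f \<boxplus> g) = sqfree_log f + sqfree_log g
    \<and> (\<forall>S. S \<noteq> {} \<longrightarrow> cumulant S (f \<boxplus> g) = cumulant S f + cumulant S g)"
  using assms by (simp add: boxplus_eq_mult cumulant_def sqfree_log_mult)

end
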